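(* Let $G$ be a finite group and $p$ a prime number. Let $\mathcal{R}$ be the set of all $p$-radical $p$-subgroups of $G$ and let $[\mathcal{R}]$ be the set of $G$-conjugacy classes $[K]$ of elements $K\in\mathcal{R}$. For subgroups $H,K\le G$ write $\mathcal{O}_G(H,K)=\{g\in G\mid H^g\subseteq K\}/K$ and $\mathcal{O}_G(K)=N_G(K)/K$. Then (1) $\displaystyle\sum_{K\in\mathcal{R}} -\widetilde{\chi}\big(\mathcal{S}^{p+*}_{\mathcal{O}_G(K)}\big)\,|K| = |G_p|$; (2) $\displaystyle\sum_{K\in\mathcal{R}} -\widetilde{\chi}\big(\mathcal{S}^{p+*}_{\mathcal{O}_G(K)}\big) = 1$; (3) $\displaystyle\sum_{[K]\in[\mathcal{R}]} -\widetilde{\chi}\big(\mathcal{S}^{p+*}_{\mathcal{O}_G(K)}\big)\,\frac{|\mathcal{O}_G(H,K)|}{|\mathcal{O}_G(K)|} = 1$ for every $p$-radical $p$-subgroup $H$ of $G$.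
   Context: $|G|_p$ is the $p$-part of $|G|$. $G_p=\{g\in G\mid g^{|G|_p}=e\}$ is the set of $p$-singular elements of $G$, i.e. the elements whose order is a power of $p$ (including the identity $e$). $H^g=g^{-1}Hg$, and $\{g\in G\mid H^g\subseteq K\}/K$ denotes the set of cosets $gK$ contained in the transporter set (morphism set of the orbit category of $G$); $\mathcal{O}_G(K)=\mathcal{O}_G(K,K)=N_G(K)/K$ is regarded as a finite group. $O_p(G)$ is the largest normal $p$-subgroup of $G$. A $p$-subgroup $H$ of $G$ is $p$-radical if $H=O_p(N_G(H))$ (the trivial subgroup is allowed). For a finite group $Q$, $\mathcal{S}^{p+*}_Q$ is the poset, ordered by inclusion, of all non-trivial $p$-subgroups of $Q$. The Euler characteristic $\chi(\mathcal{P})$ of a finite poset $\mathcal{P}$ is the sum of all entries of the inverse of its zeta matrix $(\zeta(a,b))_{a,b\in\mathcal{P}}$, where $\zeta(a,b)=1$ if $a\le b$ and $0$ otherwise (equivalently, the Euler characteristic of the order complex of $\mathcal{P}$); the reduced Euler characteristic is $\widetilde{\chi}(\mathcal{P})=\chi(\mathcal{P})-1$. In particular $\chi(\emptyset)=0$ and $\widetilde{\chi}(\emptyset)=-1$. *)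

theory Defs
  imports Complex_Main "HOL-Algebra.Group_Action" "HOL-Computational_Algebra.Primes"
begin

section \<open>Euler characteristics of finite posets\<close>

definition zeta_matrix :: "'a::order \<Rightarrow> 'a \<Rightarrow> rat" where
  "zeta_matrix a b = of_bool (a \<le> b)"

text \<open>
  A square matrix with index set \<open>P\<close> is a function of two arguments, of which only the values on
  \<open>P \<times> P\<close> matter. The inverse is made unique by letting it vanish outside \<open>P \<times> P\<close>.
\<close>
definition inverse_matrix_on :: "'a set \<Rightarrow> ('a \<Rightarrow> 'a \<Rightarrow> rat) \<Rightarrow> ('a \<Rightarrow> 'a \<Rightarrow> rat)" where
  "inverse_matrix_on P M = (THE N.
     (\<forall>a\<in>P. \<forall>b\<in>P. (\<Sum>c\<in>P. M a c * N c b) = of_bool (a = b)) \<and>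
     (\<forall>a\<in>P. \<forall>b\<in>P. (\<Sum>c\<in>P. N a c * M c b) = of_bool (a = b)) \<and>
     (\<forall>a b. \<not> (a \<in> P \<and> b \<in> P) \<longrightarrow> N a b = 0))"

definition euler_char :: "'a::order set \<Rightarrow> rat" where
  "euler_char P = (\<Sum>a\<in>P. \<Sum>b\<in>P. inverse_matrix_on P zeta_matrix a b)"

definition reduced_euler_char :: "'a::order set \<Rightarrow> rat" where
  "reduced_euler_char P = euler_char P - 1"


section \<open>Radical \<open>p\<close>-subgroups\<close>

definition p_subgroup :: "nat \<Rightarrow> ('a, 'b) monoid_scheme \<Rightarrow> 'a set \<Rightarrow> bool" where
  "p_subgroup p G H \<longleftrightarrow> subgroup H G \<and> (\<exists>n. card H = p ^ n)"

definition nontrivial_p_subgroups :: "nat \<Rightarrow> ('a, 'b) monoid_scheme \<Rightarrow> 'a set set" where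
  "nontrivial_p_subgroups p G = {H. p_subgroup p G H \<and> H \<noteq> {\<one>\<^bsub>G\<^esub>}}"

definition p_core :: "nat \<Rightarrow> ('a, 'b) monoid_scheme \<Rightarrow> 'a set" where
  "p_core p G = (GREATEST H. H \<lhd> G \<and> p_subgroup p G H)"

definition p_radical_subgroups :: "nat \<Rightarrow> ('a, 'b) monoid_scheme \<Rightarrow> 'a set set" where
  "p_radical_subgroups p G =
     {H. p_subgroup p G H \<and> H = p_core p (G\<lparr>carrier := normalizer G H\<rparr>)}"

text \<open>The elements of \<open>p\<close>-power order, including the identity.\<close>
definition p_singular_elements :: "nat \<Rightarrow> ('a, 'b) monoid_scheme \<Rightarrow> 'a set" where
  "p_singular_elements p G =
     {g \<in> carrier G. g [^]\<^bsub>G\<^esub> (p ^ multiplicity p (order G)) = \<one>\<^bsub>G\<^esub>}"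


section \<open>Conjugation and the orbit category\<close>

definition conj_subset :: "('a, 'b) monoid_scheme \<Rightarrow> 'a set \<Rightarrow> 'a \<Rightarrow> 'a set" where
  "conj_subset G H g = inv\<^bsub>G\<^esub> g <#\<^bsub>G\<^esub> H #>\<^bsub>G\<^esub> g"

definition subset_conj_class :: "('a, 'b) monoid_scheme \<Rightarrow> 'a set \<Rightarrow> 'a set set" where
  "subset_conj_class G K = conj_subset G K ` carrier G"

definition orbit_category_hom ::
  "('a, 'b) monoid_scheme \<Rightarrow> 'a set \<Rightarrow> 'a set \<Rightarrow> 'a set set" where
  "orbit_category_hom G H K =
     (\<lambda>g. g <#\<^bsub>G\<^esub> K) ` {g \<in> carrier G. conj_subset G H g \<subseteq> K}"

definition orbit_category_aut :: "('a, 'b) monoid_scheme \<Rightarrow> 'a set \<Rightarrow> 'a set monoid" where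
  "orbit_category_aut G K = (G\<lparr>carrier := normalizer G K\<rparr>) Mod K"

end

theory Submission
  imports Defs "HOL-Algebra.Zassenhaus" "HOL-Algebra.SndIsomorphismGrp"
    "HOL-Algebra.Multiplicative_Group" "HOL-Algebra.Left_Coset"
begin

text \<open>
  Let \<open>S\<close> be the poset of all \<open>p\<close>-subgroups of \<open>G\<close>, the trivial one included. The three identities are
  read off from the unique weighting of \<open>S\<close>, the function \<open>k\<close> such that the values \<open>k K\<close> with
  \<open>H \<subseteq> K\<close> sum to \<open>1\<close> for every \<open>H\<close> in \<open>S\<close>.

  In any finite poset the sum of a weighting is the Euler characteristic, and a weighting restricts to
  one of each up-closed subset. Hence \<open>k H = 1 - \<chi>(S\<^bsub>>H\<^esub>)\<close>, where \<open>S\<^bsub>>H\<^esub>\<close> consists of the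
  \<open>p\<close>-subgroups that properly contain \<open>H\<close> (\<open>weighting_reduced_euler_char\<close>). This number is the
  coefficient in the theorem. Intersecting with \<open>N\<^sub>G(H)\<close> retracts \<open>S\<^bsub>>H\<^esub>\<close> onto its members inside
  \<open>N\<^sub>G(H)\<close>, because normalizers grow in \<open>p\<close>-groups, and these members correspond to the non-trivial
  \<open>p\<close>-subgroups of \<open>N\<^sub>G(H)/H\<close> (\<open>reduced_euler_char_orbit_category_aut\<close>). The coefficient is zero unless
  \<open>H\<close> is radical: a normal \<open>p\<close>-subgroup \<open>V\<close> of \<open>N\<^sub>G(H)\<close> that is not contained in \<open>H\<close> contracts the
  poset by \<open>L \<le> VL \<ge> VH\<close> (\<open>reduced_euler_char_not_radical\<close>). So each sum over radical subgroups is a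
  sum over \<open>S\<close>. All these comparisons of posets are Galois connections, and a Galois connection
  preserves the Euler characteristic (\<open>euler_char_galois_connection\<close>).

  The second identity is now the weighting equation at the trivial subgroup. For the first one, \<open>|K|\<close>
  is expanded as a sum over the elements of \<open>K\<close> and the two summations are exchanged; an element \<open>g\<close>
  of \<open>p\<close>-power order contributes the total weight of the \<open>p\<close>-subgroups above the cyclic group that \<open>g\<close>
  generates, which is \<open>1\<close>. For the third one, \<open>|\<O>\<^sub>G(H,K)| / |\<O>\<^sub>G(K)|\<close> is the number of conjugates
  of \<open>K\<close> that contain \<open>H\<close> (\<open>card_orbit_category_hom\<close>), so that the sum over conjugacy classes is the
  weighting equation at \<open>H\<close>.
\<close>

section \<open>Weightings and the Euler characteristic of a finite poset\<close>

text \<open>Solutions of \<open>\<zeta> k = 1\<close> and of \<open>l \<zeta> = 1\<close>, that is, the row sums and the column sums of the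
  inverse of the zeta matrix.\<close>
definition weighting :: "'a::order set \<Rightarrow> ('a \<Rightarrow> rat) \<Rightarrow> bool" where
  "weighting P k \<longleftrightarrow> (\<forall>a\<in>P. (\<Sum>b | b \<in> P \<and> a \<le> b. k b) = 1)"

definition coweighting :: "'a::order set \<Rightarrow> ('a \<Rightarrow> rat) \<Rightarrow> bool" where
  "coweighting P l \<longleftrightarrow> (\<forall>b\<in>P. (\<Sum>a | a \<in> P \<and> a \<le> b. l a) = 1)"

lemma sum_zeta_matrix:
  assumes "finite P"
  shows "(\<Sum>c\<in>P. zeta_matrix a c * k c) = (\<Sum>c | c \<in> P \<and> a \<le> c. k c)"
    and "(\<Sum>c\<in>P. k c * zeta_matrix c a) = (\<Sum>c | c \<in> P \<and> c \<le> a. k c)"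
  by (auto simp: zeta_matrix_def sum.inter_filter[OF assms] intro!: sum.cong)

text \<open>The system \<open>\<zeta> k = f\<close> is triangular: a minimal element \<open>m\<close> occurs only in the equation for \<open>m\<close>
  itself, so that the value at \<open>m\<close> can be chosen last.\<close>
lemma zeta_system_solvable:
  fixes P :: "'a::order set" and f :: "'a \<Rightarrow> rat"
  assumes "finite P"
  shows "\<exists>k. \<forall>a\<in>P. (\<Sum>b | b \<in> P \<and> a \<le> b. k b) = f a"
  using assms
proof (induction P rule: finite_psubset_induct)
  case (psubset P)
  show ?case
  proof (cases "P = {}")
    case False
    then obtain m where m: "m \<in> P" "\<And>a. a \<in> P \<Longrightarrow> a \<le> m \<Longrightarrow> m = a"
      using finite_has_minimal[OF psubset.hyps] by metis
    then obtain k where k: "\<forall>a\<in>P - {m}. (\<Sum>b | b \<in> P - {m} \<and> a \<le> b. k b) = f a"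
      using psubset.IH[of "P - {m}"] by blast
    define k' where "k' = k(m := f m - (\<Sum>b | b \<in> P - {m} \<and> m \<le> b. k b))"
    have "(\<Sum>b | b \<in> P \<and> a \<le> b. k' b) = f a" if "a \<in> P" for a
    proof (cases "a = m")
      case True
      have "{b. b \<in> P \<and> a \<le> b} = insert m {b. b \<in> P - {m} \<and> m \<le> b}"
        using m(1) True by auto
      then show ?thesis
        using psubset.hyps True by (simp add: k'_def)
    next
      case False
      have "(\<Sum>b | b \<in> P \<and> a \<le> b. k' b) = (\<Sum>b | b \<in> P - {m} \<and> a \<le> b. k b)"
        using m False that by (intro sum.cong) (auto simp: k'_def)
      then show ?thesis
        using k False that by auto
    qed
    then show ?thesis by blast
  qed auto
qed

lemma zeta_system_unique:
  fixes P :: "'a::order set" and k :: "'a \<Rightarrow> rat"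
  assumes "finite P" and zero: "\<forall>a\<in>P. (\<Sum>b | b \<in> P \<and> a \<le> b. k b) = 0" and "a \<in> P"
  shows "k a = 0"
proof (rule ccontr)
  assume "k a \<noteq> 0"
  then obtain m where m: "m \<in> P" "k m \<noteq> 0" "\<And>b. b \<in> P \<Longrightarrow> k b \<noteq> 0 \<Longrightarrow> m \<le> b \<Longrightarrow> b = m"
    using finite_has_maximal[of "{b \<in> P. k b \<noteq> 0}"] assms(1,3) by auto
  have "(\<Sum>b | b \<in> P \<and> m \<le> b. k b) = (\<Sum>b\<in>{m}. k b)"
    using m assms(1) by (intro sum.mono_neutral_right) auto
  then show False
    using zero m by auto
qed

text \<open>Solving for the columns of the unit matrix gives a right inverse of the zeta matrix. It is a
  left inverse because \<open>\<zeta> (N \<zeta> - 1) = 0\<close> and \<open>\<zeta>\<close> is injective.\<close>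
lemma inverse_zeta_matrix:
  fixes P :: "'a::order set"
  defines "N \<equiv> inverse_matrix_on P zeta_matrix"
  assumes fin: "finite P"
  shows "\<And>a b. a \<in> P \<Longrightarrow> b \<in> P \<Longrightarrow> (\<Sum>c\<in>P. zeta_matrix a c * N c b) = of_bool (a = b)"
    and "\<And>a b. a \<in> P \<Longrightarrow> b \<in> P \<Longrightarrow> (\<Sum>c\<in>P. N a c * zeta_matrix c b) = of_bool (a = b)"
proof -
  let ?inv = "\<lambda>N. (\<forall>a\<in>P. \<forall>b\<in>P. (\<Sum>c\<in>P. zeta_matrix a c * N c b) = of_bool (a = b)) \<and>
     (\<forall>a\<in>P. \<forall>b\<in>P. (\<Sum>c\<in>P. N a c * zeta_matrix c b) = of_bool (a = b)) \<and>
     (\<forall>a b. \<not> (a \<in> P \<and> b \<in> P) \<longrightarrow> N a b = 0)"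
  have "\<forall>b. \<exists>k. \<forall>a\<in>P. (\<Sum>c | c \<in> P \<and> a \<le> c. k c) = (of_bool (a = b) :: rat)"
    by (intro allI zeta_system_solvable fin)
  then obtain col where col: "\<And>a b. a \<in> P \<Longrightarrow> (\<Sum>c | c \<in> P \<and> a \<le> c. col b c) = (of_bool (a = b) :: rat)"
    by metis
  define M where "M a b = (if a \<in> P \<and> b \<in> P then col b a else 0)" for a b
  have right: "(\<Sum>c\<in>P. zeta_matrix a c * M c b) = of_bool (a = b)" if "a \<in> P" "b \<in> P" for a b
    using that fin col[OF that(1), of b] by (auto simp: sum_zeta_matrix M_def cong: sum.cong)
  have left: "(\<Sum>c\<in>P. M a c * zeta_matrix c b) = of_bool (a = b)" if ab: "a \<in> P" "b \<in> P" for a b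
  proof -
    define d where "d a = (\<Sum>c\<in>P. M a c * zeta_matrix c b) - of_bool (a = b)" for a
    have "(\<Sum>c | c \<in> P \<and> x \<le> c. d c) = 0" if x: "x \<in> P" for x
    proof -
      have "(\<Sum>c | c \<in> P \<and> x \<le> c. d c) = (\<Sum>c\<in>P. zeta_matrix x c * d c)"
        using fin by (simp add: sum_zeta_matrix)
      also have "\<dots> = (\<Sum>c\<in>P. \<Sum>e\<in>P. zeta_matrix x c * M c e * zeta_matrix e b)
                     - (\<Sum>c\<in>P. zeta_matrix x c * of_bool (c = b))"
        by (simp add: d_def right_diff_distrib sum_subtractf sum_distrib_left mult.assoc)
      also have "(\<Sum>c\<in>P. \<Sum>e\<in>P. zeta_matrix x c * M c e * zeta_matrix e b)
                 = (\<Sum>e\<in>P. (\<Sum>c\<in>P. zeta_matrix x c * M c e) * zeta_matrix e b)"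
        by (subst sum.swap) (simp add: sum_distrib_right)
      also have "\<dots> = (\<Sum>e\<in>P. of_bool (x = e) * zeta_matrix e b)"
        using x by (intro sum.cong) (auto simp: right)
      finally show ?thesis
        using fin x ab by (simp add: of_bool_def if_distrib if_distribR cong: if_cong)
    qed
    then have "d a = 0"
      using zeta_system_unique[OF fin _ ab(1), of d] by blast
    then show ?thesis by (simp add: d_def)
  qed
  have M: "?inv M"
    using left right by (auto simp: M_def)
  have "N' = M" if N': "?inv N'" for N'
  proof (intro ext)
    fix a b
    show "N' a b = M a b"
    proof (cases "a \<in> P \<and> b \<in> P")
      case True
      have "(\<Sum>c | c \<in> P \<and> x \<le> c. N' c b - M c b) = 0" if "x \<in> P" for x
      proof -
        have "(\<Sum>c\<in>P. zeta_matrix x c * N' c b) = (\<Sum>c\<in>P. zeta_matrix x c * M c b)"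
          using N' right True that by simp
        then show ?thesis
          using fin by (simp add: sum_zeta_matrix sum_subtractf)
      qed
      then show ?thesis
        using zeta_system_unique[OF fin, of "\<lambda>c. N' c b - M c b" a] True by simp
    qed (use N' in \<open>auto simp: M_def\<close>)
  qed
  then have "N = M"
    unfolding N_def inverse_matrix_on_def using M by (intro the_equality) blast+
  then show "\<And>a b. a \<in> P \<Longrightarrow> b \<in> P \<Longrightarrow> (\<Sum>c\<in>P. zeta_matrix a c * N c b) = of_bool (a = b)"
    and "\<And>a b. a \<in> P \<Longrightarrow> b \<in> P \<Longrightarrow> (\<Sum>c\<in>P. N a c * zeta_matrix c b) = of_bool (a = b)"
    using left right by auto
qed

lemma weighting_exists:
  assumes "finite P"
  obtains k where "weighting P k"
  using zeta_system_solvable[OF assms, of "\<lambda>_. 1"] unfolding weighting_def by blast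

lemma euler_char_coweighting:
  assumes fin: "finite P"
  obtains l where "coweighting P l" "euler_char P = (\<Sum>a\<in>P. l a)"
proof
  let ?N = "inverse_matrix_on P zeta_matrix"
  show "euler_char P = (\<Sum>b\<in>P. \<Sum>a\<in>P. ?N a b)"
    unfolding euler_char_def by (rule sum.swap)
  show "coweighting P (\<lambda>b. \<Sum>a\<in>P. ?N a b)"
    unfolding coweighting_def
  proof
    fix b assume b: "b \<in> P"
    have "(\<Sum>c | c \<in> P \<and> c \<le> b. \<Sum>a\<in>P. ?N a c) = (\<Sum>c\<in>P. \<Sum>a\<in>P. ?N a c * zeta_matrix c b)"
      using fin by (simp add: sum_zeta_matrix(2)[symmetric] sum_distrib_right)
    also have "\<dots> = (\<Sum>a\<in>P. of_bool (a = b))"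
      by (subst sum.swap) (simp add: inverse_zeta_matrix[OF fin] b cong: sum.cong)
    finally show "(\<Sum>c | c \<in> P \<and> c \<le> b. \<Sum>a\<in>P. ?N a c) = 1"
      using fin b by (simp add: of_bool_def)
  qed
qed

text \<open>Summing \<open>l a * k b\<close> over all pairs with \<open>a \<le> g b\<close>, equivalently \<open>f a \<le> b\<close>, yields the total
  weight of \<open>k\<close> or that of \<open>l\<close>, depending on the variable that is summed first.\<close>
lemma sum_weighting_eq_sum_coweighting:
  fixes P :: "'a::order set" and Q :: "'b::order set"
  assumes fin: "finite P" "finite Q"
    and f: "f \<in> P \<rightarrow> Q" and g: "g \<in> Q \<rightarrow> P"
    and adj: "\<And>a b. a \<in> P \<Longrightarrow> b \<in> Q \<Longrightarrow> f a \<le> b \<longleftrightarrow> a \<le> g b"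
    and k: "weighting Q k" and l: "coweighting P l"
  shows "(\<Sum>b\<in>Q. k b) = (\<Sum>a\<in>P. l a)"
proof -
  have "(\<Sum>b\<in>Q. k b) = (\<Sum>b\<in>Q. k b * (\<Sum>a | a \<in> P \<and> a \<le> g b. l a))"
    using g l by (intro sum.cong) (auto simp: coweighting_def)
  also have "\<dots> = (\<Sum>b\<in>Q. \<Sum>a | a \<in> P \<and> f a \<le> b. k b * l a)"
    by (auto simp: sum_distrib_left adj intro!: sum.cong)
  also have "\<dots> = (\<Sum>a\<in>P. \<Sum>b | b \<in> Q \<and> f a \<le> b. k b * l a)"
    by (rule sum.swap_restrict[OF fin(2,1)])
  also have "\<dots> = (\<Sum>a\<in>P. (\<Sum>b | b \<in> Q \<and> f a \<le> b. k b) * l a)"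
    by (simp add: sum_distrib_right)
  also have "\<dots> = (\<Sum>a\<in>P. l a)"
    using f k by (intro sum.cong) (auto simp: weighting_def)
  finally show ?thesis .
qed

lemma euler_char_eq_sum_weighting:
  assumes "finite P" "weighting P k"
  shows "euler_char P = (\<Sum>a\<in>P. k a)"
proof -
  obtain l where "coweighting P l" "euler_char P = (\<Sum>a\<in>P. l a)"
    using euler_char_coweighting[OF assms(1)] .
  then show ?thesis
    using sum_weighting_eq_sum_coweighting[of P P id id k l] assms by auto
qed

text \<open>The two maps of a Galois connection are mutually inverse homotopy equivalences of the order
  complexes. For the Euler characteristic this amounts to a double count. All
  comparisons of posets of subgroups below, isomorphisms included, are instances.\<close>
lemma euler_char_galois_connection:
  fixes P :: "'a::order set" and Q :: "'b::order set"
  assumes "finite P" "finite Q" "f \<in> P \<rightarrow> Q" "g \<in> Q \<rightarrow> P"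
    and "\<And>a b. a \<in> P \<Longrightarrow> b \<in> Q \<Longrightarrow> f a \<le> b \<longleftrightarrow> a \<le> g b"
  shows "euler_char P = euler_char Q"
proof -
  obtain l where l: "coweighting P l" "euler_char P = (\<Sum>a\<in>P. l a)"
    using euler_char_coweighting[OF assms(1)] .
  obtain k where k: "weighting Q k"
    using weighting_exists[OF assms(2)] .
  show ?thesis
    using sum_weighting_eq_sum_coweighting[OF assms k l(1)] euler_char_eq_sum_weighting[OF assms(2) k] l(2)
    by simp
qed

lemma euler_char_singleton: "euler_char {a :: 'a::order} = 1"
proof -
  have "{b. b = a \<and> a \<le> b} = {a}" by auto
  then have "weighting {a} (\<lambda>_. 1)" by (simp add: weighting_def)
  then show ?thesis using euler_char_eq_sum_weighting[of "{a}"] by simp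
qed

lemma euler_char_least:
  fixes P :: "'a::order set"
  assumes "finite P" "m \<in> P" "\<And>a. a \<in> P \<Longrightarrow> m \<le> a"
  shows "euler_char P = 1"
  using euler_char_galois_connection[of "{m}" P "\<lambda>_. m" "\<lambda>_. m"] assms euler_char_singleton[of m]
  by auto

text \<open>A weighting restricts to one of every up-closed subset. Hence the weights above an element \<open>a\<close>
  sum to \<open>\<chi>(P\<^bsub>>a\<^esub>)\<close>, which leaves \<open>1 - \<chi>(P\<^bsub>>a\<^esub>)\<close> for \<open>a\<close> itself.\<close>
lemma weighting_reduced_euler_char:
  fixes P :: "'a::order set"
  assumes fin: "finite P"
  shows "weighting P (\<lambda>a. - reduced_euler_char {b \<in> P. a < b})"
proof -
  obtain k where k: "weighting P k"
    using weighting_exists[OF fin] .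
  have "k a = - reduced_euler_char {b \<in> P. a < b}" if a: "a \<in> P" for a
  proof -
    have "{c \<in> {b \<in> P. a < b}. b \<le> c} = {c \<in> P. b \<le> c}" if "a < b" for b
      using that by auto
    then have "weighting {b \<in> P. a < b} k"
      using k by (auto simp: weighting_def)
    then have "euler_char {b \<in> P. a < b} = (\<Sum>b | b \<in> P \<and> a < b. k b)"
      using fin by (intro euler_char_eq_sum_weighting) auto
    moreover have "{b. b \<in> P \<and> a \<le> b} = insert a {b. b \<in> P \<and> a < b}"
      using a by auto
    then have "k a + (\<Sum>b | b \<in> P \<and> a < b. k b) = 1"
      using k a fin by (auto simp: weighting_def)
    ultimately show ?thesis
      by (simp add: reduced_euler_char_def)
  qed
  then have "(\<Sum>b | b \<in> P \<and> a \<le> b. - reduced_euler_char {c \<in> P. b < c})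
      = (\<Sum>b | b \<in> P \<and> a \<le> b. k b)" for a
    by (intro sum.cong) auto
  then show ?thesis
    using k by (simp add: weighting_def)
qed

section \<open>Subgroups of prime power order\<close>

locale finite_group_prime = group G for G (structure) +
  fixes p :: nat
  assumes finite_carrier: "finite (carrier G)" and prime_p: "Factorial_Ring.prime p"
begin

lemma subgroup_finite: "subgroup H G \<Longrightarrow> finite H"
  using finite_carrier subgroup.subset finite_subset by blast

lemma finite_group_prime_subgroup:
  "subgroup H G \<Longrightarrow> finite_group_prime (G\<lparr>carrier := H\<rparr>) p"
  using subgroup_imp_group subgroup_finite prime_p
  by (simp add: finite_group_prime_def finite_group_prime_axioms_def)

lemma card_dvd_prime_power_iff: "(\<exists>n. d dvd p ^ n) \<longleftrightarrow> (\<exists>n. d = p ^ n)"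
  using divides_primepow_nat[OF prime_p] by blast

lemma p_subgroup_imp_subgroup: "p_subgroup p G H \<Longrightarrow> subgroup H G"
  by (simp add: p_subgroup_def)

lemma finite_p_subgroups: "finite {K. p_subgroup p G K}"
  by (rule finite_subset[of _ "Pow (carrier G)"])
     (auto simp: p_subgroup_def finite_carrier dest: subgroup.subset)

lemma p_subgroup_restrict_iff:
  assumes "subgroup N G"
  shows "p_subgroup p (G\<lparr>carrier := N\<rparr>) L \<longleftrightarrow> p_subgroup p G L \<and> L \<subseteq> N"
  using assms subgroup_incl[of L N] incl_subgroup[of N L] subgroup.subset[of L "G\<lparr>carrier := N\<rparr>"]
  by (auto simp: p_subgroup_def)

lemma card_subgroup_dvd:
  assumes "subgroup L G" "subgroup K G" "L \<subseteq> K"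
  shows "card L dvd card K"
proof -
  have "card (rcosets\<^bsub>G\<lparr>carrier := K\<rparr>\<^esub> L) * card L = card K"
    using group.lagrange[OF subgroup_imp_group[OF assms(2)] subgroup_incl[OF assms]]
    by (simp add: order_def)
  then show ?thesis by (metis dvd_triv_right)
qed

lemma p_subgroup_subset:
  assumes "p_subgroup p G K" "subgroup L G" "L \<subseteq> K"
  shows "p_subgroup p G L"
  using assms card_subgroup_dvd[of L K] card_dvd_prime_power_iff[of "card L"]
  by (auto simp: p_subgroup_def)

lemma p_subgroup_one: "p_subgroup p G {\<one>}"
  using triv_subgroup by (auto simp: p_subgroup_def intro: exI[of _ 0])

text \<open>By the second isomorphism theorem \<open>HL/H\<close> is a quotient of \<open>L\<close>, so that \<open>|HL|\<close> divides
  \<open>|H| |L|\<close>.\<close>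
lemma p_subgroup_set_mult:
  assumes "H \<lhd> G" "p_subgroup p G H" "p_subgroup p G L"
  shows "p_subgroup p G (H <#> L)"
proof -
  have L: "subgroup L G" using assms by (simp add: p_subgroup_def)
  interpret second_isomorphism_grp H G L
    using assms(1) L by (simp add: second_isomorphism_grp_def second_isomorphism_grp_axioms_def)
  have HL: "subgroup (H <#> L) G" by (rule normal_set_mult_subgroup)
  interpret HL: group "G\<lparr>carrier := H <#> L\<rparr>" by (rule subgroup_imp_group[OF HL])
  interpret LG: group "G\<lparr>carrier := L\<rparr>" by (rule subgroup_imp_group[OF L])
  have "order (G\<lparr>carrier := H <#> L\<rparr> Mod H) = order (G\<lparr>carrier := L\<rparr> Mod (H \<inter> L))"
    by (rule iso_same_order[OF normal_intersection_quotient_isom, symmetric])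
  then have "card (rcosets\<^bsub>G\<lparr>carrier := H <#> L\<rparr>\<^esub> H) = card (rcosets\<^bsub>G\<lparr>carrier := L\<rparr>\<^esub> (H \<inter> L))"
    by (simp add: order_def FactGroup_def)
  moreover have "card (rcosets\<^bsub>G\<lparr>carrier := H <#> L\<rparr>\<^esub> H) * card H = card (H <#> L)"
    using HL.lagrange[OF subgroup_incl[OF is_subgroup HL H_contained_in_set_mult]]
    by (simp add: order_def)
  moreover have "card (rcosets\<^bsub>G\<lparr>carrier := L\<rparr>\<^esub> (H \<inter> L)) * card (H \<inter> L) = card L"
    using LG.lagrange[OF subgroup_incl[OF subgroups_Inter_pair[OF is_subgroup L] L]]
    by (simp add: order_def)
  ultimately have "card (H <#> L) dvd card L * card H"
    by (metis dvd_triv_left mult_dvd_mono dvd_refl)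
  also obtain m n where "card L * card H = p ^ (m + n)"
    using assms by (auto simp: p_subgroup_def power_add)
  finally show ?thesis
    using HL card_dvd_prime_power_iff[of "card (H <#> L)"] by (auto simp: p_subgroup_def)
qed

end

text \<open>Every orbit of more than one point has cardinality divisible by \<open>p\<close>.\<close>
lemma (in group_action) prime_power_order_fixed_points:
  assumes p: "Factorial_Ring.prime p" and order: "order G = p ^ n"
    and C: "C \<subseteq> E" "finite C" and closed: "\<And>g x. g \<in> carrier G \<Longrightarrow> x \<in> C \<Longrightarrow> \<phi> g x \<in> C"
    and dvd: "p dvd card C"
  shows "p dvd card {x \<in> C. \<forall>g\<in>carrier G. \<phi> g x = x}"
proof -
  define F where "F = {x \<in> C. \<forall>g\<in>carrier G. \<phi> g x = x}"
  define D where "D = C - F"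
  have D: "D \<subseteq> C" "D \<subseteq> E" using C by (auto simp: D_def)
  interpret G: group G
    using group_hom group_hom.axioms(1) by auto
  have sub: "orbit G \<phi> x \<subseteq> D" if x: "x \<in> D" for x
  proof
    fix y assume y: "y \<in> orbit G \<phi> x"
    then have "y \<in> C" using x closed D by (auto simp: orbit_def)
    moreover have "x = y" if "\<forall>g\<in>carrier G. \<phi> g y = y"
    proof -
      have "x \<in> orbit G \<phi> y"
        by (rule orbit_sym) (use x y \<open>y \<in> C\<close> C(1) D in blast)+
      then show ?thesis using that by (auto simp: orbit_def)
    qed
    ultimately show "y \<in> D" using x by (auto simp: D_def F_def)
  qed
  have un: "\<Union>(orbit G \<phi> ` D) = D"
  proof
    show "\<Union>(orbit G \<phi> ` D) \<subseteq> D" using sub by auto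
    show "D \<subseteq> \<Union>(orbit G \<phi> ` D)" using orbit_refl D(2) by auto
  qed
  have "p dvd card c" if c: "c \<in> (orbit G \<phi> ` D)" for c
  proof -
    obtain x where x: "x \<in> C" "x \<notin> F" "c = orbit G \<phi> x" using c by (auto simp: D_def)
    then have "x \<in> E" using C by auto
    then have "card c dvd p ^ n"
      using orbit_stabilizer_theorem[of x] order x(3) by (metis dvd_triv_left)
    then obtain i where i: "card c = p ^ i"
      using divides_primepow_nat[OF p] by blast
    have "i \<noteq> 0"
    proof
      assume "i = 0"
      then have "card c = 1" using i by simp
      then obtain y where "c = {y}" using card_1_singletonE by blast
      then have "c = {x}" using orbit_refl[OF \<open>x \<in> E\<close>] x(3) by auto
      then show False using x by (auto simp: orbit_def F_def)
    qed
    then show ?thesis using i by simp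
  qed
  moreover have "c1 \<inter> c2 = {}" if "c1 \<in> (orbit G \<phi> ` D)" "c2 \<in> (orbit G \<phi> ` D)" "c1 \<noteq> c2" for c1 c2
    using disjoint_union[of c1 c2] that D(2) by (auto simp: orbits_def)
  ultimately have "p dvd card (\<Union>(orbit G \<phi> ` D))"
    using finite_subset[OF D(1) C(2)] un by (intro dvd_partition) auto
  then have "p dvd card D" by (simp add: un)
  moreover have "C = D \<union> F" "D \<inter> F = {}" "finite D" "finite F"
    using C(2) by (auto simp: D_def F_def)
  then have "card C = card D + card F"
    by (simp add: card_Un_disjoint)
  ultimately show ?thesis
    using dvd dvd_add_right_iff[of p "card D" "card F"] by (simp add: F_def)
qed

section \<open>Conjugation and normalizers\<close>

context group
begin

lemma conj_subset_image: "conj_subset G H g = (\<lambda>h. inv g \<otimes> h \<otimes> g) ` H"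
  by (auto simp: conj_subset_def l_coset_def r_coset_def)

lemma conj_subset_one [simp]: "H \<subseteq> carrier G \<Longrightarrow> conj_subset G H \<one> = H"
  by (force simp: conj_subset_image)

lemma conj_subset_carrier:
  "H \<subseteq> carrier G \<Longrightarrow> g \<in> carrier G \<Longrightarrow> conj_subset G H g \<subseteq> carrier G"
  by (auto simp: conj_subset_image)

lemma conj_subset_mono: "H \<subseteq> K \<Longrightarrow> conj_subset G H g \<subseteq> conj_subset G K g"
  by (auto simp: conj_subset_image)

lemma conj_subset_mult:
  assumes "H \<subseteq> carrier G" "g \<in> carrier G" "h \<in> carrier G"
  shows "conj_subset G (conj_subset G H g) h = conj_subset G H (g \<otimes> h)"
  using assms by (auto simp: conj_subset_image image_image inv_mult_group m_assoc subsetD intro!: image_cong)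

lemma conj_subset_inv [simp]:
  assumes "H \<subseteq> carrier G" "g \<in> carrier G"
  shows "conj_subset G (conj_subset G H g) (inv g) = H"
    and "conj_subset G (conj_subset G H (inv g)) g = H"
  using assms by (simp_all add: conj_subset_mult)

lemma conj_subset_subset_iff:
  assumes "H \<subseteq> carrier G" "K \<subseteq> carrier G" "g \<in> carrier G"
  shows "conj_subset G H g \<subseteq> K \<longleftrightarrow> H \<subseteq> conj_subset G K (inv g)"
  using assms conj_subset_mono[of "conj_subset G H g" K "inv g"]
    conj_subset_mono[of H "conj_subset G K (inv g)" g] by auto

lemma card_conj_subset:
  assumes "H \<subseteq> carrier G" "g \<in> carrier G"
  shows "card (conj_subset G H g) = card H"
  unfolding conj_subset_image using assms
  by (intro card_image inj_onI) (auto simp: subsetD)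

lemma conj_subset_subgroup:
  assumes "subgroup H G" "g \<in> carrier G"
  shows "subgroup (conj_subset G H g) G"
proof (rule subgroupI)
  have H: "\<And>h. h \<in> H \<Longrightarrow> h \<in> carrier G" using assms subgroup.mem_carrier by fast
  show "conj_subset G H g \<subseteq> carrier G" "conj_subset G H g \<noteq> {}"
    using H assms subgroup.one_closed[OF assms(1)] by (auto simp: conj_subset_image)
  fix a b assume "a \<in> conj_subset G H g"
  then obtain h where h: "h \<in> H" "a = inv g \<otimes> h \<otimes> g" by (auto simp: conj_subset_image)
  have "inv a = inv g \<otimes> inv h \<otimes> g" using h H assms by (simp add: inv_mult_group m_assoc)
  then show "inv a \<in> conj_subset G H g"
    using subgroup.m_inv_closed[OF assms(1) h(1)] by (auto simp: conj_subset_image)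
  assume "b \<in> conj_subset G H g"
  then obtain k where k: "k \<in> H" "b = inv g \<otimes> k \<otimes> g" by (auto simp: conj_subset_image)
  have "g \<otimes> (inv g \<otimes> (k \<otimes> g)) = k \<otimes> g"
    using k H assms by (simp flip: m_assoc)
  then have "a \<otimes> b = inv g \<otimes> (h \<otimes> k) \<otimes> g"
    using h k H assms by (simp add: m_assoc)
  then show "a \<otimes> b \<in> conj_subset G H g"
    using subgroup.m_closed[OF assms(1) h(1) k(1)] by (auto simp: conj_subset_image)
qed

lemma mem_normalizer_iff:
  assumes "H \<subseteq> carrier G"
  shows "g \<in> normalizer G H \<longleftrightarrow> g \<in> carrier G \<and> conj_subset G H (inv g) = H"
  using assms by (auto simp: normalizer_def stabilizer_def conj_subset_def)

end

context finite_group_prime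
begin

lemma subset_normalizer: "subgroup H G \<Longrightarrow> H \<subseteq> normalizer G H"
  using subgroup_in_normalizer normal_imp_subgroup subgroup.subset by fastforce

lemma normalizer_subgroup: "subgroup H G \<Longrightarrow> subgroup (normalizer G H) G"
  by (simp add: normalizer_imp_subgroup subgroup.subset)

text \<open>If \<open>H\<close> were its own normalizer in \<open>L\<close>, the conjugates of \<open>H\<close> under \<open>L\<close> would be \<open>|L : H|\<close> in
  number, a multiple of \<open>p\<close>. So \<open>H\<close>, acting on them by conjugation, would fix besides itself another
  conjugate \<open>gHg\<^sup>-\<^sup>1\<close>. But then \<open>g\<^sup>-\<^sup>1Hg\<close> normalizes \<open>H\<close> and therefore
  equals \<open>H\<close>, a contradiction.\<close>
lemma normalizer_grows:
  assumes L: "p_subgroup p G L" and H: "subgroup H G" and HL: "H \<subset> L"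
  shows "H \<subset> L \<inter> normalizer G H"
proof (rule ccontr)
  assume "\<not> ?thesis"
  then have self: "L \<inter> normalizer G H = H"
    using HL subset_normalizer[OF H] by auto
  have sL: "subgroup L G" using L by (rule p_subgroup_imp_subgroup)
  have HG: "H \<subseteq> carrier G" and LG: "L \<subseteq> carrier G"
    using H sL by (auto dest: subgroup.subset)
  define E where "E = {A. A \<subseteq> carrier G}"
  define \<phi> where "\<phi> = (\<lambda>g. \<lambda>A\<in>E. g <# A #> inv g)"
  have \<phi>: "\<phi> g A = conj_subset G A (inv g)" if "g \<in> carrier G" "A \<subseteq> carrier G" for g A
    using that by (simp add: \<phi>_def E_def conj_subset_def)
  have act: "group_action G E \<phi>"
    unfolding \<phi>_def E_def by (rule action_by_conjugation_on_power_set)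
  interpret L: group_action "G\<lparr>carrier := L\<rparr>" E \<phi>
    using group_action.induced_action[OF act sL] .
  interpret H: group_action "G\<lparr>carrier := H\<rparr>" E \<phi>
    using group_action.induced_action[OF act H] .
  have HE: "H \<in> E" using HG by (simp add: E_def)
  define C where "C = orbit (G\<lparr>carrier := L\<rparr>) \<phi> H"
  have "stabilizer (G\<lparr>carrier := L\<rparr>) \<phi> H = L \<inter> normalizer G H"
    using LG HG by (auto simp: stabilizer_def mem_normalizer_iff \<phi>)
  then have card_C: "card C * card H = card L"
    using L.orbit_stabilizer_theorem[OF HE] self by (simp add: C_def order_def)
  have finL: "finite L" using sL by (rule subgroup_finite)
  have "p dvd card C"
  proof -
    have "card H < card L" using HL finL by (rule psubset_card_mono[rotated])
    then have "card C \<noteq> 1" using card_C by auto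
    moreover obtain n where "card L = p ^ n" using L by (auto simp: p_subgroup_def)
    then obtain i where "card C = p ^ i"
      using card_C divides_primepow_nat[OF prime_p, of "card C" n] by (metis dvd_triv_left)
    ultimately show ?thesis by (cases i) auto
  qed
  moreover obtain m where "card H = p ^ m"
    using p_subgroup_subset[OF L H] HL by (auto simp: p_subgroup_def)
  moreover have CE: "C \<subseteq> E"
    unfolding C_def orbit_def using L.element_image[OF _ HE] by auto
  moreover have "finite C"
    using finL by (simp add: C_def orbit_def)
  moreover have "\<phi> h x \<in> C" if h: "h \<in> H" and x: "x \<in> C" for h x
  proof -
    obtain g where g: "g \<in> L" "x = \<phi> g H" using x by (auto simp: C_def orbit_def)
    have "h \<in> L" using h HL by auto
    then have "\<phi> h x = \<phi> (h \<otimes> g) H" "h \<otimes> g \<in> L"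
      using L.composition_rule[OF HE, of h g] g subgroup.m_closed[OF sL] by auto
    then show ?thesis by (auto simp: C_def orbit_def)
  qed
  ultimately have dvd: "p dvd card {x \<in> C. \<forall>h\<in>H. \<phi> h x = x}" (is "_ dvd card ?F")
    using H.prime_power_order_fixed_points[OF prime_p, of m C] by (simp add: order_def)
  have finF: "finite ?F" using \<open>finite C\<close> by simp
  have "H \<in> ?F"
    using L.orbit_refl[OF HE] subset_normalizer[OF H] HG by (auto simp: C_def mem_normalizer_iff \<phi>)
  have "?F \<noteq> {H}"
  proof
    assume "?F = {H}"
    then have "p dvd 1" using dvd by simp
    then show False using prime_p not_prime_unit by blast
  qed
  then obtain x where x: "x \<in> C" "\<And>h. h \<in> H \<Longrightarrow> \<phi> h x = x" "x \<noteq> H"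
    using \<open>H \<in> ?F\<close> by blast
  then obtain g where g: "g \<in> L" "x = \<phi> g H" by (auto simp: C_def orbit_def)
  have gG: "g \<in> carrier G" using g LG by auto
  then have xg: "x = conj_subset G H (inv g)" using g HG by (simp add: \<phi>)
  \<comment> \<open>An \<open>h\<close> in \<open>H\<close> normalizes \<open>gHg\<^sup>-\<^sup>1\<close>, so \<open>g\<^sup>-\<^sup>1hg\<close> normalizes \<open>H\<close>.\<close>
  have "conj_subset G H g \<subseteq> H"
  proof
    fix y assume "y \<in> conj_subset G H g"
    then obtain h where h: "h \<in> H" "y = inv g \<otimes> h \<otimes> g" by (auto simp: conj_subset_image)
    have hG: "h \<in> carrier G" using h HG by auto
    have "conj_subset G x (inv h) = x"
      using x(2)[OF h(1)] hG gG HG by (simp add: \<phi> xg conj_subset_carrier)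
    then have "conj_subset G (conj_subset G x (inv h)) g = H"
      using gG HG by (simp add: xg)
    then have "conj_subset G H (inv y) = H"
      using gG hG HG by (simp add: xg h conj_subset_mult conj_subset_carrier inv_mult_group m_assoc)
    then have "y \<in> normalizer G H"
      using HG gG hG h by (simp add: mem_normalizer_iff)
    moreover have "y \<in> L"
      using h g HL sL by (auto intro!: subgroup.m_closed[OF sL] subgroup.m_inv_closed[OF sL])
    ultimately show "y \<in> H" using self by auto
  qed
  then have "conj_subset G H g = H"
    using card_subset_eq[OF subgroup_finite[OF H]] card_conj_subset[OF HG gG] by blast
  then have "x = H"
    using conj_subset_inv(1)[OF HG gG] by (simp add: xg)
  with x(3) show False ..
qed

section \<open>Euler characteristics of posets of \<open>p\<close>-subgroups\<close>

text \<open>Taking cosets and taking unions of cosets are the two directions of the correspondence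
  theorem. Together they form a Galois connection between the subgroups above \<open>H\<close> and those of the
  quotient.\<close>
lemma euler_char_p_subgroups_quotient:
  assumes H: "H \<lhd> G" "p_subgroup p G H"
  shows "euler_char {L. p_subgroup p G L \<and> H \<subset> L}
       = euler_char (nontrivial_p_subgroups p (G Mod H))"
proof -
  interpret normal H G by (rule H(1))
  interpret Q: group "G Mod H" by (rule factorgroup_is_group)
  interpret q: group_hom G "G Mod H" "\<lambda>x. H #> x"
    using r_coset_hom_Mod by (simp add: group_hom_def group_hom_axioms_def Q.is_group)
  let ?P = "{L. p_subgroup p G L \<and> H \<subset> L}"
  have carrier_Q: "carrier (G Mod H) = rcosets H"
    by (simp add: FactGroup_def)
  then have finQ: "finite (carrier (G Mod H))"
    using finite_carrier by (simp add: RCOSETS_def)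
  have card_cosets: "card (rcosets\<^bsub>G\<lparr>carrier := L\<rparr>\<^esub> H) * card H = card L"
    if "subgroup L G" "H \<subseteq> L" for L
    using group.lagrange[OF subgroup_imp_group[OF that(1)] subgroup_incl[OF is_subgroup that]]
    by (simp add: order_def)
  have cosets: "(#>) H ` L = rcosets\<^bsub>G\<lparr>carrier := L\<rparr>\<^esub> H" for L
    by (auto simp: RCOSETS_def)
  have f: "(#>) H ` L \<in> nontrivial_p_subgroups p (G Mod H)" if L: "L \<in> ?P" for L
  proof -
    have sL: "subgroup L G" using L by (simp add: p_subgroup_def)
    have "card ((#>) H ` L) dvd card L"
      using card_cosets[OF sL] L by (metis (no_types, lifting) cosets dvd_triv_left mem_Collect_eq psubset_imp_subset)
    then have "\<exists>n. card ((#>) H ` L) = p ^ n"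
      using L card_dvd_prime_power_iff[of "card ((#>) H ` L)"] by (auto simp: p_subgroup_def)
    moreover have "subgroup ((#>) H ` L) (G Mod H)"
      using sL by (rule q.subgroup_img_is_subgroup)
    moreover have "(#>) H ` L \<noteq> {H}"
    proof
      assume "(#>) H ` L = {H}"
      then have "H #> x = H" if "x \<in> L" for x
        using that by auto
      then have "L \<subseteq> H"
        using coset_join1[OF _ _ is_subgroup] subgroup.mem_carrier[OF sL] by (intro subsetI) simp
      then show False using L by auto
    qed
    ultimately show ?thesis
      by (simp add: nontrivial_p_subgroups_def p_subgroup_def)
  qed
  have g: "\<Union>A \<in> ?P" if A: "A \<in> nontrivial_p_subgroups p (G Mod H)" for A
  proof -
    have sA: "subgroup A (G Mod H)"
      using A by (simp add: nontrivial_p_subgroups_def p_subgroup_def)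
    then have sU: "subgroup (\<Union>A) G" by (rule factgroup_subgroup_union_subgroup)
    have "H \<in> A" using subgroup.one_closed[OF sA] by simp
    then have HU: "H \<subseteq> \<Union>A" by auto
    have "card (\<Union>A) = card A * card H"
      using card_cosets[OF sU HU] factgroup_subgroup_union_factor[OF sA] by simp
    then have "\<exists>n. card (\<Union>A) = p ^ n"
      using A H(2) by (auto simp: nontrivial_p_subgroups_def p_subgroup_def simp flip: power_add)
    moreover have "\<Union>A \<noteq> H"
    proof
      assume eq: "\<Union>A = H"
      have "\<forall>B\<in>A. B = H"
      proof
        fix B assume "B \<in> A"
        obtain x where x: "x \<in> carrier G" "B = H #> x"
          using subgroup.subset[OF sA] \<open>B \<in> A\<close> by (auto simp: carrier_FactGroup)
        then have "x \<in> H" using rcos_self[OF x(1) is_subgroup] eq \<open>B \<in> A\<close> by auto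
        then show "B = H" using x coset_join2[OF x(1) is_subgroup] by simp
      qed
      then have "A = {H}" using \<open>H \<in> A\<close> by blast
      then show False using A by (simp add: nontrivial_p_subgroups_def)
    qed
    ultimately show ?thesis using sU HU by (auto simp: p_subgroup_def)
  qed
  show ?thesis
  proof (rule euler_char_galois_connection)
    show "finite ?P" using finite_p_subgroups by (rule rev_finite_subset) auto
    show "finite (nontrivial_p_subgroups p (G Mod H))"
      by (rule finite_subset[of _ "Pow (carrier (G Mod H))"])
         (auto simp: nontrivial_p_subgroups_def p_subgroup_def finQ dest: subgroup.subset)
    show "(\<lambda>L. (#>) H ` L) \<in> ?P \<rightarrow> nontrivial_p_subgroups p (G Mod H)"
      using f by blast
    show "Union \<in> nontrivial_p_subgroups p (G Mod H) \<rightarrow> ?P"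
      using g by blast
    fix L A assume "L \<in> ?P" and A: "A \<in> nontrivial_p_subgroups p (G Mod H)"
    then have L: "x \<in> carrier G" if "x \<in> L" for x
      using that by (auto simp: p_subgroup_def dest: subgroup.mem_carrier)
    have "\<Union>A = {x \<in> carrier G. H #> x \<in> A}"
      using A by (intro factgroup_subgroup_union_char) (simp add: nontrivial_p_subgroups_def p_subgroup_def)
    then show "(#>) H ` L \<le> A \<longleftrightarrow> L \<le> \<Union>A"
      using L by auto
  qed
qed

text \<open>The poset is contractible through \<open>L \<le> VL \<ge> VH\<close>.\<close>
lemma euler_char_p_subgroups_normal:
  assumes H: "p_subgroup p G H"
    and V: "V \<lhd> G" "p_subgroup p G V" "\<not> V \<subseteq> H"
  shows "euler_char {L. p_subgroup p G L \<and> H \<subset> L} = 1"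
proof -
  let ?P = "{L. p_subgroup p G L \<and> H \<subset> L}" and ?Q = "{L. p_subgroup p G L \<and> H \<subset> L \<and> V \<subseteq> L}"
  have sub: "V \<subseteq> V <#> L" "L \<subseteq> V <#> L" if "p_subgroup p G L" for L
    using second_isomorphism_grp.H_contained_in_set_mult[of V G L]
      second_isomorphism_grp.S_contained_in_set_mult[of V G L] V(1) that
    by (auto simp: second_isomorphism_grp_def second_isomorphism_grp_axioms_def p_subgroup_def)
  have least: "V <#> L \<subseteq> M" if "p_subgroup p G M" "V \<subseteq> M" "L \<subseteq> M" for L M
    using that by (auto simp: set_mult_def p_subgroup_def subgroup.m_closed subsetD)
  have fin: "finite ?P" "finite ?Q"
    by (rule rev_finite_subset[OF finite_p_subgroups]; blast)+
  have "euler_char ?P = euler_char ?Q"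
  proof (rule euler_char_galois_connection[OF fin])
    show "(<#>) V \<in> ?P \<rightarrow> ?Q"
    proof
      fix L assume "L \<in> ?P"
      then show "V <#> L \<in> ?Q"
        using sub[of L] p_subgroup_set_mult[OF V(1,2), of L] by auto
    qed
    show "(\<lambda>L. L) \<in> ?Q \<rightarrow> ?P" by auto
    fix L M assume "L \<in> ?P" "M \<in> ?Q"
    then show "V <#> L \<le> M \<longleftrightarrow> L \<le> M"
      using sub[of L] least[of M L] by auto
  qed
  also have "euler_char ?Q = 1"
  proof (rule euler_char_least[OF fin(2)])
    show "V <#> H \<in> ?Q"
      using sub[OF H] p_subgroup_set_mult[OF V(1,2) H] V(3) by auto
    show "V <#> H \<le> M" if "M \<in> ?Q" for M
      using that least[of M H] by auto
  qed
  finally show ?thesis .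
qed

text \<open>The retraction \<open>L \<mapsto> N\<^sub>L(H)\<close> stays strictly above \<open>H\<close> because normalizers grow.\<close>
lemma euler_char_p_subgroups_normalizer:
  assumes H: "p_subgroup p G H"
  defines "N \<equiv> G\<lparr>carrier := normalizer G H\<rparr>"
  shows "euler_char {L. p_subgroup p G L \<and> H \<subset> L} = euler_char {L. p_subgroup p N L \<and> H \<subset> L}"
proof (rule euler_char_galois_connection[symmetric])
  let ?P = "{L. p_subgroup p G L \<and> H \<subset> L}" and ?Q = "{L. p_subgroup p N L \<and> H \<subset> L}"
  have sH: "subgroup H G" using H by (rule p_subgroup_imp_subgroup)
  note sN = normalizer_subgroup[OF sH]
  have N: "p_subgroup p N L \<longleftrightarrow> p_subgroup p G L \<and> L \<subseteq> normalizer G H" for L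
    unfolding N_def by (rule p_subgroup_restrict_iff[OF sN])
  show "finite ?P" using finite_p_subgroups by (rule rev_finite_subset) auto
  then show "finite ?Q" by (rule rev_finite_subset) (auto simp: N)
  show "(\<lambda>L. L) \<in> ?Q \<rightarrow> ?P" by (auto simp: N)
  show "(\<lambda>L. L \<inter> normalizer G H) \<in> ?P \<rightarrow> ?Q"
  proof
    fix L assume L: "L \<in> ?P"
    have "p_subgroup p G (L \<inter> normalizer G H)"
      by (rule p_subgroup_subset[of L]) (use L subgroups_Inter_pair[OF _ sN] p_subgroup_imp_subgroup in auto)
    then show "L \<inter> normalizer G H \<in> ?Q"
      using normalizer_grows[OF _ sH, of L] L by (simp add: N)
  qed
  show "L \<le> M \<longleftrightarrow> L \<le> M \<inter> normalizer G H" if "L \<in> ?Q" for L M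
    using that by (auto simp: N)
qed

lemma p_core_eq:
  assumes H: "H \<lhd> G" "p_subgroup p G H"
    and max: "\<And>V. V \<lhd> G \<Longrightarrow> p_subgroup p G V \<Longrightarrow> V \<subseteq> H"
  shows "p_core p G = H"
  unfolding p_core_def using assms by (intro Greatest_equality) auto

text \<open>This carries the Euler characteristic from the quotient \<open>N\<^sub>G(H)/H\<close>, which varies with \<open>H\<close>, back to
  the one poset of all \<open>p\<close>-subgroups of \<open>G\<close>.\<close>
lemma reduced_euler_char_orbit_category_aut:
  assumes H: "p_subgroup p G H"
  shows "reduced_euler_char (nontrivial_p_subgroups p (orbit_category_aut G H))
       = reduced_euler_char {L. p_subgroup p G L \<and> H \<subset> L}"
proof -
  have sH: "subgroup H G" using H by (rule p_subgroup_imp_subgroup)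
  interpret N: finite_group_prime "G\<lparr>carrier := normalizer G H\<rparr>" p
    using normalizer_subgroup[OF sH] by (rule finite_group_prime_subgroup)
  have "p_subgroup p (G\<lparr>carrier := normalizer G H\<rparr>) H"
    using H subset_normalizer[OF sH] by (simp add: p_subgroup_restrict_iff[OF normalizer_subgroup[OF sH]])
  then show ?thesis
    using euler_char_p_subgroups_normalizer[OF H] N.euler_char_p_subgroups_quotient[OF subgroup_in_normalizer[OF sH]]
    by (simp add: reduced_euler_char_def orbit_category_aut_def)
qed

text \<open>If \<open>H\<close> is not radical, some normal \<open>p\<close>-subgroup of its normalizer is not contained in \<open>H\<close>, and
  the poset above \<open>H\<close> is contractible.\<close>
lemma reduced_euler_char_not_radical:
  assumes H: "p_subgroup p G H" and not_radical: "H \<notin> p_radical_subgroups p G"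
  shows "reduced_euler_char (nontrivial_p_subgroups p (orbit_category_aut G H)) = 0"
proof -
  have sH: "subgroup H G" using H by (rule p_subgroup_imp_subgroup)
  interpret N: finite_group_prime "G\<lparr>carrier := normalizer G H\<rparr>" p
    using normalizer_subgroup[OF sH] by (rule finite_group_prime_subgroup)
  have HN: "p_subgroup p (G\<lparr>carrier := normalizer G H\<rparr>) H"
    using H subset_normalizer[OF sH] by (simp add: p_subgroup_restrict_iff[OF normalizer_subgroup[OF sH]])
  obtain V where "V \<lhd> G\<lparr>carrier := normalizer G H\<rparr>"
    "p_subgroup p (G\<lparr>carrier := normalizer G H\<rparr>) V" "\<not> V \<subseteq> H"
    using not_radical H N.p_core_eq[OF subgroup_in_normalizer[OF sH] HN]
    by (auto simp: p_radical_subgroups_def)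
  then show ?thesis
    using N.euler_char_p_subgroups_normal[OF HN] euler_char_p_subgroups_normalizer[OF H]
    by (simp add: reduced_euler_char_orbit_category_aut[OF H]) (simp add: reduced_euler_char_def)
qed

end

section \<open>Conjugates above a subgroup\<close>

context finite_group_prime
begin

lemma subset_conj_class_conj_subset:
  assumes "K \<subseteq> carrier G" "g \<in> carrier G"
  shows "subset_conj_class G (conj_subset G K g) = subset_conj_class G K"
proof -
  have "(\<otimes>) g ` carrier G = carrier G"
  proof
    have "h \<in> (\<otimes>) g ` carrier G" if "h \<in> carrier G" for h
      using assms that by (intro image_eqI[of _ _ "inv g \<otimes> h"]) (simp_all flip: m_assoc)
    then show "carrier G \<subseteq> (\<otimes>) g ` carrier G" by blast
  qed (use assms in auto)
  then have "subset_conj_class G K = (\<lambda>h. conj_subset G K (g \<otimes> h)) ` carrier G"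
    unfolding subset_conj_class_def image_image[of "conj_subset G K" "(\<otimes>) g", symmetric] by simp
  also have "\<dots> = subset_conj_class G (conj_subset G K g)"
    unfolding subset_conj_class_def using assms by (intro image_cong) (simp_all add: conj_subset_mult)
  finally show ?thesis ..
qed

text \<open>The set of all \<open>g\<close> with \<open>H\<^sup>g \<subseteq> K\<close> is a union of cosets \<open>gK\<close>. It is also the disjoint union of
  the sets of all \<open>g\<close> with \<open>gKg\<^sup>-\<^sup>1 = K'\<close>, where \<open>K'\<close> ranges over the conjugates of \<open>K\<close> above \<open>H\<close>, and
  each of these sets is a coset of the normalizer of \<open>K\<close>.\<close>
lemma card_orbit_category_hom:
  assumes H: "H \<subseteq> carrier G" and K: "subgroup K G"
  shows "card (orbit_category_hom G H K)
       = card {K' \<in> subset_conj_class G K. H \<subseteq> K'} * card (carrier (orbit_category_aut G K))"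
proof -
  have KG: "K \<subseteq> carrier G" using K by (rule subgroup.subset)
  have finK: "finite K" using K by (rule subgroup_finite)
  let ?N = "normalizer G K"
  have N: "subgroup ?N G" using K by (rule normalizer_subgroup)
  define X where "X = {g \<in> carrier G. conj_subset G H g \<subseteq> K}"
  have finX: "finite X" using finite_carrier by (simp add: X_def)
  have card_l_coset: "card (g <# A) = card A" if "g \<in> carrier G" "A \<subseteq> carrier G" for g A
  proof -
    have "g <# A = (\<lambda>a. g \<otimes> a) ` A" by (auto simp: l_coset_def)
    then show ?thesis using that by (auto intro!: card_image inj_onI simp: subsetD)
  qed
  have X_closed: "g \<otimes> k \<in> X" if g: "g \<in> X" and k: "k \<in> K" for g k
  proof -
    have "conj_subset G (conj_subset G H g) k \<subseteq> K"
    proof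
      fix y assume "y \<in> conj_subset G (conj_subset G H g) k"
      then obtain x where "x \<in> conj_subset G H g" "y = inv k \<otimes> x \<otimes> k"
        unfolding conj_subset_image[of _ k] by blast
      then show "y \<in> K"
        using g k K by (auto simp: X_def intro!: subgroup.m_closed[OF K] subgroup.m_inv_closed[OF K])
    qed
    moreover have "g \<in> carrier G" "k \<in> carrier G"
      using g k KG by (auto simp: X_def)
    ultimately show ?thesis
      using H by (simp add: X_def conj_subset_mult)
  qed
  have hom: "orbit_category_hom G H K = (\<lambda>g. g <# K) ` X"
    by (simp add: orbit_category_hom_def X_def)
  have "\<Union>((\<lambda>g. g <# K) ` X) = X"
  proof
    show "\<Union>((\<lambda>g. g <# K) ` X) \<subseteq> X"
      using X_closed by (auto simp: l_coset_def)
    show "X \<subseteq> \<Union>((\<lambda>g. g <# K) ` X)"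
      using lcos_self[OF _ K] by (auto simp: X_def)
  qed
  moreover have "card K * card ((\<lambda>g. g <# K) ` X) = card (\<Union>((\<lambda>g. g <# K) ` X))"
  proof (rule card_partition)
    show "finite ((\<lambda>g. g <# K) ` X)" using finX by simp
    show "finite (\<Union>((\<lambda>g. g <# K) ` X))" using finX calculation by simp
    show "card c = card K" if "c \<in> (\<lambda>g. g <# K) ` X" for c
      using that card_l_coset KG by (auto simp: X_def)
    fix c d assume "c \<in> (\<lambda>g. g <# K) ` X" "d \<in> (\<lambda>g. g <# K) ` X" "c \<noteq> d"
    then have "c \<in> lcosets K" "d \<in> lcosets K" "c \<noteq> d"
      by (auto simp: LCOSETS_def X_def)
    then show "c \<inter> d = {}"
      by (rule lcos_disjoint[OF K])
  qed
  ultimately have card_X: "card (orbit_category_hom G H K) * card K = card X"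
    by (simp add: hom mult.commute)
  have card_N: "card (carrier (orbit_category_aut G K)) * card K = card ?N"
    using group.lagrange[OF subgroup_imp_group[OF N] subgroup_incl[OF K N subset_normalizer[OF K]]]
    by (simp add: orbit_category_aut_def FactGroup_def order_def)
  let ?C = "{K' \<in> subset_conj_class G K. H \<subseteq> K'}"
  let ?F = "\<lambda>K'. {g \<in> carrier G. conj_subset G K (inv g) = K'}"
  have fiber: "card (?F K') = card ?N" if K': "K' \<in> ?C" for K'
  proof -
    obtain a where a: "a \<in> carrier G" "K' = conj_subset G K a"
      using K' by (auto simp: subset_conj_class_def)
    have "?F K' = inv a <# ?N"
    proof
      show "?F K' \<subseteq> inv a <# ?N"
      proof
        fix g assume "g \<in> ?F K'"
        then have g: "g \<in> carrier G" "conj_subset G K (inv g) = conj_subset G K a" using a by auto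
        then have "conj_subset G (conj_subset G K (inv g)) (inv a) = K"
          using a KG by simp
        then have "a \<otimes> g \<in> ?N"
          using a g(1) KG by (simp add: mem_normalizer_iff conj_subset_mult inv_mult_group)
        moreover have "g = inv a \<otimes> (a \<otimes> g)" using a g(1) by (simp flip: m_assoc)
        ultimately show "g \<in> inv a <# ?N" by (auto simp: l_coset_def)
      qed
      show "inv a <# ?N \<subseteq> ?F K'"
      proof
        fix g assume "g \<in> inv a <# ?N"
        then obtain n where n: "n \<in> ?N" "g = inv a \<otimes> n" by (auto simp: l_coset_def)
        then have nG: "n \<in> carrier G" "conj_subset G K (inv n) = K"
          using KG by (auto simp: mem_normalizer_iff)
        have "conj_subset G (conj_subset G K (inv n)) a = conj_subset G K (inv g)"
          using conj_subset_mult[of K "inv n" a] a nG(1) KG n(2) by (simp add: inv_mult_group)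
        then have "conj_subset G K (inv g) = conj_subset G K a"
          using nG by simp
        then show "g \<in> ?F K'" using nG a n by simp
      qed
    qed
    then show ?thesis
      using a(1) subgroup.subset[OF N] by (simp add: card_l_coset)
  qed
  have finC: "finite ?C" using finite_carrier by (simp add: subset_conj_class_def)
  have X: "X = {g \<in> carrier G. H \<subseteq> conj_subset G K (inv g)}"
    unfolding X_def using conj_subset_subset_iff[OF H KG] by blast
  have "X = (\<Union>K'\<in>?C. ?F K')"
    unfolding X subset_conj_class_def by (auto intro: inv_closed)
  then have "card X = (\<Sum>K'\<in>?C. card (?F K'))"
    using finC finite_carrier by (simp only:) (rule card_UN_disjoint, auto)
  then have "card X = card ?C * card ?N"
    using fiber by simp
  then have "card (orbit_category_hom G H K) * card K
      = card ?C * card (carrier (orbit_category_aut G K)) * card K"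
    using card_X card_N by (simp add: mult.assoc)
  moreover have "card K > 0"
    using finK subgroup.one_closed[OF K] by (auto simp: card_gt_0_iff)
  ultimately show ?thesis by simp
qed

lemma orbit_category_hom_ratio:
  assumes "H \<subseteq> carrier G" "subgroup K G"
  shows "of_nat (card (orbit_category_hom G H K)) / of_nat (card (carrier (orbit_category_aut G K)))
       = (of_nat (card {K' \<in> subset_conj_class G K. H \<subseteq> K'}) :: 'c::field_char_0)"
proof -
  interpret N: normal K "G\<lparr>carrier := normalizer G K\<rparr>"
    using assms(2) by (rule subgroup_in_normalizer)
  interpret Q: group "orbit_category_aut G K"
    unfolding orbit_category_aut_def by (rule N.factorgroup_is_group)
  have "finite (normalizer G K)"
    using assms(2) normalizer_subgroup subgroup_finite by blast
  then have "finite (carrier (orbit_category_aut G K))"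
    by (simp add: orbit_category_aut_def FactGroup_def RCOSETS_def)
  then have "card (carrier (orbit_category_aut G K)) \<noteq> 0"
    using Q.one_closed by auto
  then show ?thesis
    using card_orbit_category_hom[OF assms] by simp
qed

section \<open>Sums over the radical \<open>p\<close>-subgroups\<close>

text \<open>The coefficient that the three identities share.\<close>
definition orbit_weight :: "'a set \<Rightarrow> rat" where
  "orbit_weight K = - reduced_euler_char (nontrivial_p_subgroups p (orbit_category_aut G K))"

lemma orbit_weight_eq:
  "p_subgroup p G K \<Longrightarrow> orbit_weight K = - reduced_euler_char {L. p_subgroup p G L \<and> K \<subset> L}"
  by (simp add: orbit_weight_def reduced_euler_char_orbit_category_aut)

text \<open>All three identities are consequences of this equation. It holds because the weighting of a poset is
  given by the reduced Euler characteristics of the strict up-sets, with opposite sign.\<close>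
lemma sum_orbit_weight_above:
  assumes "p_subgroup p G H"
  shows "(\<Sum>K | p_subgroup p G K \<and> H \<subseteq> K. orbit_weight K) = 1"
proof -
  have "(\<Sum>K | p_subgroup p G K \<and> H \<subseteq> K. orbit_weight K)
      = (\<Sum>K | p_subgroup p G K \<and> H \<subseteq> K. - reduced_euler_char {L. p_subgroup p G L \<and> K \<subset> L})"
    by (intro sum.cong) (auto simp: orbit_weight_eq)
  then show ?thesis
    using weighting_reduced_euler_char[OF finite_p_subgroups] assms by (simp add: weighting_def)
qed

lemma p_subgroup_imp_subset: "p_subgroup p G L \<Longrightarrow> L \<subseteq> carrier G"
  by (auto simp: p_subgroup_def dest: subgroup.subset)

lemma p_subgroup_conj_subset:
  "p_subgroup p G L \<Longrightarrow> g \<in> carrier G \<Longrightarrow> p_subgroup p G (conj_subset G L g)"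
  using conj_subset_subgroup[of L g] card_conj_subset[OF p_subgroup_imp_subset, of L g]
  by (simp add: p_subgroup_def)

text \<open>Conjugation by \<open>g\<close> and by \<open>g\<^sup>-\<^sup>1\<close> identifies the \<open>p\<close>-subgroups above \<open>K\<close> with those above
  \<open>K\<^sup>g\<close>.\<close>
lemma orbit_weight_conj_subset:
  assumes K: "p_subgroup p G K" and g: "g \<in> carrier G"
  shows "orbit_weight (conj_subset G K g) = orbit_weight K"
proof -
  note sub = p_subgroup_imp_subset and conj = p_subgroup_conj_subset
  let ?P = "\<lambda>K. {L. p_subgroup p G L \<and> K \<subset> L}"
  have fin: "finite (?P M)" for M
    using finite_p_subgroups by (rule rev_finite_subset) auto
  have maps: "(\<lambda>L. conj_subset G L h) \<in> ?P M \<rightarrow> ?P (conj_subset G M h)"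
    if h: "h \<in> carrier G" and M: "p_subgroup p G M" for h M
  proof
    fix L assume L: "L \<in> ?P M"
    have "conj_subset G L h \<noteq> conj_subset G M h"
    proof
      assume "conj_subset G L h = conj_subset G M h"
      then have "conj_subset G (conj_subset G L h) (inv h) = conj_subset G (conj_subset G M h) (inv h)"
        by simp
      then show False using L M h sub by simp
    qed
    then show "conj_subset G L h \<in> ?P (conj_subset G M h)"
      using L conj[OF _ h] conj_subset_mono[of M L h] by auto
  qed
  have "euler_char (?P K) = euler_char (?P (conj_subset G K g))"
  proof (rule euler_char_galois_connection[OF fin fin])
    show "(\<lambda>L. conj_subset G L g) \<in> ?P K \<rightarrow> ?P (conj_subset G K g)"
      using maps[OF g K] .
    show "(\<lambda>L. conj_subset G L (inv g)) \<in> ?P (conj_subset G K g) \<rightarrow> ?P K"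
      using maps[OF inv_closed[OF g] conj[OF K g]] g sub[OF K] by simp
    show "conj_subset G A g \<le> B \<longleftrightarrow> A \<le> conj_subset G B (inv g)"
      if "A \<in> ?P K" "B \<in> ?P (conj_subset G K g)" for A B
      using that sub g by (intro conj_subset_subset_iff) auto
  qed
  then show ?thesis
    by (simp add: orbit_weight_eq K conj[OF K g] reduced_euler_char_def)
qed

text \<open>The weight vanishes off the radical subgroups. Below, \<open>A\<close> is the set of radical subgroups or the
  union of their conjugacy classes.\<close>
lemma sum_radical_eq_sum_p_subgroups:
  assumes "p_radical_subgroups p G \<subseteq> A" "A \<subseteq> {K. p_subgroup p G K}"
  shows "(\<Sum>K\<in>A. orbit_weight K * f K) = (\<Sum>K | p_subgroup p G K. orbit_weight K * f K)"
  using assms finite_p_subgroups reduced_euler_char_not_radical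
  by (intro sum.mono_neutral_left) (auto simp: orbit_weight_def)

lemma p_subgroup_subset_p_singular_elements:
  assumes "p_subgroup p G K"
  shows "K \<subseteq> p_singular_elements p G"
proof
  fix g assume g: "g \<in> K"
  have K: "subgroup K G" using assms by (rule p_subgroup_imp_subgroup)
  have gG: "g \<in> carrier G" using subgroup.mem_carrier[OF K g] .
  obtain n where n: "card K = p ^ n" using assms by (auto simp: p_subgroup_def)
  have "order G \<noteq> 0" using order_gt_0_iff_finite finite_carrier by simp
  moreover have "p ^ n dvd order G"
    using lagrange[OF K] n by (metis dvd_triv_right)
  ultimately have "n \<le> multiplicity p (order G)"
    using prime_p by (intro multiplicity_geI) auto
  then have "p ^ n dvd p ^ multiplicity p (order G)"
    by (rule le_imp_power_dvd)
  moreover have "ord g dvd p ^ n"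
    using card_subgroup_dvd[OF generate_is_subgroup K] generate_subgroup_incl[OF _ K, of "{g}"]
      generate_pow_card[OF gG] g gG n by simp
  ultimately have "ord g dvd p ^ multiplicity p (order G)"
    using dvd_trans by blast
  then show "g \<in> p_singular_elements p G"
    using gG by (simp add: p_singular_elements_def pow_eq_id)
qed

lemma p_subgroup_generate:
  assumes "g \<in> p_singular_elements p G"
  shows "p_subgroup p G (generate G {g})"
proof -
  have g: "g \<in> carrier G" using assms by (simp add: p_singular_elements_def)
  then have "card (generate G {g}) dvd p ^ multiplicity p (order G)"
    using assms by (simp add: p_singular_elements_def pow_eq_id generate_pow_card)
  then show ?thesis
    using g generate_is_subgroup card_dvd_prime_power_iff[of "card (generate G {g})"]
    by (auto simp: p_subgroup_def)
qed

lemma sum_orbit_weight_radical: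
  "(\<Sum>K\<in>p_radical_subgroups p G. orbit_weight K) = 1"
proof -
  have "(\<Sum>K\<in>p_radical_subgroups p G. orbit_weight K) = (\<Sum>K | p_subgroup p G K. orbit_weight K)"
    using sum_radical_eq_sum_p_subgroups[of "p_radical_subgroups p G" "\<lambda>_. 1"]
    by (auto simp: p_radical_subgroups_def)
  also have "{K. p_subgroup p G K} = {K. p_subgroup p G K \<and> {\<one>} \<subseteq> K}"
    by (auto simp: p_subgroup_def subgroup.one_closed)
  finally show ?thesis
    using sum_orbit_weight_above[OF p_subgroup_one] by simp
qed

text \<open>The \<open>p\<close>-subgroups containing \<open>g\<close> are those above the cyclic group generated by \<open>g\<close>, so that
  every \<open>g\<close> of \<open>p\<close>-power order is counted with total weight \<open>1\<close>.\<close>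
lemma sum_orbit_weight_card_radical:
  "(\<Sum>K\<in>p_radical_subgroups p G. orbit_weight K * of_nat (card K))
    = of_nat (card (p_singular_elements p G))"
proof -
  let ?P = "p_singular_elements p G"
  have finP: "finite ?P" using finite_carrier by (simp add: p_singular_elements_def)
  have "(\<Sum>K\<in>p_radical_subgroups p G. orbit_weight K * of_nat (card K))
      = (\<Sum>K | p_subgroup p G K. orbit_weight K * of_nat (card K))"
    by (rule sum_radical_eq_sum_p_subgroups) (auto simp: p_radical_subgroups_def)
  also have "\<dots> = (\<Sum>K | p_subgroup p G K. \<Sum>g | g \<in> ?P \<and> g \<in> K. orbit_weight K)"
  proof (intro sum.cong refl)
    fix K assume "K \<in> {K. p_subgroup p G K}"
    then have "{g. g \<in> ?P \<and> g \<in> K} = K"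
      using p_subgroup_subset_p_singular_elements by auto
    then show "orbit_weight K * of_nat (card K) = (\<Sum>g | g \<in> ?P \<and> g \<in> K. orbit_weight K)"
      by (simp add: mult.commute)
  qed
  also have "\<dots> = (\<Sum>g\<in>?P. \<Sum>K | K \<in> {K. p_subgroup p G K} \<and> g \<in> K. orbit_weight K)"
    by (rule sum.swap_restrict[OF finite_p_subgroups finP])
  also have "\<dots> = (\<Sum>g\<in>?P. 1)"
  proof (intro sum.cong refl)
    fix g assume g: "g \<in> ?P"
    then have gG: "g \<in> carrier G" by (simp add: p_singular_elements_def)
    have "g \<in> K \<longleftrightarrow> generate G {g} \<subseteq> K" if "p_subgroup p G K" for K
      using generate_subgroup_incl[of "{g}" K] generate.incl[of g "{g}" G] that
      by (auto simp: p_subgroup_def)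
    then have "{K. K \<in> {K. p_subgroup p G K} \<and> g \<in> K} = {K. p_subgroup p G K \<and> generate G {g} \<subseteq> K}"
      by auto
    then show "(\<Sum>K | K \<in> {K. p_subgroup p G K} \<and> g \<in> K. orbit_weight K) = 1"
      using sum_orbit_weight_above[OF p_subgroup_generate[OF g]] by simp
  qed
  finally show ?thesis by simp
qed

text \<open>The fraction counts the conjugates of \<open>rep C\<close> above \<open>H\<close>, and all of them have the same weight. So
  the sum runs over the \<open>p\<close>-subgroups above \<open>H\<close>, one conjugacy class after the other.\<close>
lemma sum_orbit_weight_conj_classes:
  assumes H: "p_subgroup p G H"
    and rep: "\<And>C. C \<in> subset_conj_class G ` p_radical_subgroups p G \<Longrightarrow> rep C \<in> C"
  shows "(\<Sum>C\<in>subset_conj_class G ` p_radical_subgroups p G. orbit_weight (rep C) *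
           (of_nat (card (orbit_category_hom G H (rep C))) /
            of_nat (card (carrier (orbit_category_aut G (rep C)))))) = 1"
proof -
  let ?Cs = "subset_conj_class G ` p_radical_subgroups p G"
  let ?S = "{K. p_subgroup p G K}"
  have class_p: "C \<subseteq> ?S" if "C \<in> ?Cs" for C
    using that p_subgroup_conj_subset by (auto simp: subset_conj_class_def p_radical_subgroups_def)
  have class_eq: "subset_conj_class G K = C" if C: "C \<in> ?Cs" and K: "K \<in> C" for C K
  proof -
    obtain L where L: "p_subgroup p G L" "C = subset_conj_class G L"
      using C by (auto simp: p_radical_subgroups_def)
    then obtain g where "g \<in> carrier G" "K = conj_subset G L g"
      using K by (auto simp: subset_conj_class_def)
    then show ?thesis
      using subset_conj_class_conj_subset[OF p_subgroup_imp_subset] L by simp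
  qed
  have weight_eq: "orbit_weight K = orbit_weight L" if "C \<in> ?Cs" "K \<in> C" "L \<in> C" for C K L
    using class_eq[OF that(1,2)] class_p[OF that(1)] orbit_weight_conj_subset[of K] that(2,3)
    by (auto simp: subset_conj_class_def)
  have finCs: "finite ?Cs"
    using finite_p_subgroups by (intro finite_imageI) (auto intro: rev_finite_subset simp: p_radical_subgroups_def)
  have finC: "finite C" if "C \<in> ?Cs" for C
    using class_p[OF that] finite_p_subgroups by (rule finite_subset)
  have rad: "p_radical_subgroups p G \<subseteq> \<Union>?Cs"
  proof
    fix K assume K: "K \<in> p_radical_subgroups p G"
    then have "conj_subset G K \<one> = K"
      by (intro conj_subset_one p_subgroup_imp_subset) (simp add: p_radical_subgroups_def)
    then have "K \<in> subset_conj_class G K"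
      by (auto simp: subset_conj_class_def intro: rev_image_eqI)
    then show "K \<in> \<Union>?Cs" using K by blast
  qed
  have "(\<Sum>C\<in>?Cs. orbit_weight (rep C) * (of_nat (card (orbit_category_hom G H (rep C))) /
            of_nat (card (carrier (orbit_category_aut G (rep C))))))
      = (\<Sum>C\<in>?Cs. \<Sum>K\<in>C. orbit_weight K * of_bool (H \<subseteq> K))"
  proof (intro sum.cong refl)
    fix C assume C: "C \<in> ?Cs"
    then have "subgroup (rep C) G"
      using class_p[OF C] rep[OF C] by (auto simp: p_subgroup_def)
    then have "orbit_weight (rep C) * (of_nat (card (orbit_category_hom G H (rep C))) /
            of_nat (card (carrier (orbit_category_aut G (rep C)))))
        = orbit_weight (rep C) * of_nat (card {K \<in> C. H \<subseteq> K})"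
      by (subst orbit_category_hom_ratio[OF p_subgroup_imp_subset[OF H]])
         (simp_all add: class_eq[OF C rep[OF C]])
    also have "\<dots> = orbit_weight (rep C) * (\<Sum>K\<in>C. of_bool (H \<subseteq> K))"
      using finC[OF C] by (simp add: Int_def)
    also have "\<dots> = (\<Sum>K\<in>C. orbit_weight K * of_bool (H \<subseteq> K))"
      unfolding sum_distrib_left using weight_eq[OF C _ rep[OF C]] by (intro sum.cong) auto
    finally show "orbit_weight (rep C) * (of_nat (card (orbit_category_hom G H (rep C))) /
            of_nat (card (carrier (orbit_category_aut G (rep C)))))
        = (\<Sum>K\<in>C. orbit_weight K * of_bool (H \<subseteq> K))" .
  qed
  also have "\<dots> = (\<Sum>K\<in>\<Union>?Cs. orbit_weight K * of_bool (H \<subseteq> K))"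
  proof (rule sum.Union_disjoint[symmetric, simplified comp_def])
    show "\<forall>C\<in>?Cs. finite C" using finC by blast
    show "\<forall>C\<in>?Cs. \<forall>D\<in>?Cs. C \<noteq> D \<longrightarrow> C \<inter> D = {}"
      using class_eq by blast
  qed
  also have "\<dots> = (\<Sum>K\<in>?S. orbit_weight K * of_bool (H \<subseteq> K))"
    using rad class_p by (intro sum_radical_eq_sum_p_subgroups) auto
  also have "\<dots> = (\<Sum>K | p_subgroup p G K \<and> H \<subseteq> K. orbit_weight K)"
    using finite_p_subgroups by (simp add: Int_def)
  finally show ?thesis
    using sum_orbit_weight_above[OF H] by simp
qed

end

theorem proposition2p3:
  fixes G :: "('a, 'b) monoid_scheme" and p :: nat
  assumes "group G" and "finite (carrier G)" and "Factorial_Ring.prime p"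
  shows
    "(\<Sum>K\<in>p_radical_subgroups p G.
        - reduced_euler_char (nontrivial_p_subgroups p (orbit_category_aut G K)) * of_nat (card K))
       = of_nat (card (p_singular_elements p G)) \<and>
     (\<Sum>K\<in>p_radical_subgroups p G.
        - reduced_euler_char (nontrivial_p_subgroups p (orbit_category_aut G K))) = 1 \<and>
     (\<forall>H\<in>p_radical_subgroups p G. \<forall>rep.
        (\<forall>C\<in>subset_conj_class G ` p_radical_subgroups p G. rep C \<in> C) \<longrightarrow>
        (\<Sum>C\<in>subset_conj_class G ` p_radical_subgroups p G.
           - reduced_euler_char (nontrivial_p_subgroups p (orbit_category_aut G (rep C))) *
             (of_nat (card (orbit_category_hom G H (rep C))) /
              of_nat (card (carrier (orbit_category_aut G (rep C)))))) = 1)"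
proof -
  interpret finite_group_prime G p
    using assms by (simp add: finite_group_prime_def finite_group_prime_axioms_def)
  show ?thesis
  proof (intro conjI ballI allI impI, goal_cases)
    case 1
    show ?case using sum_orbit_weight_card_radical unfolding orbit_weight_def .
  next
    case 2
    show ?case using sum_orbit_weight_radical unfolding orbit_weight_def .
  next
    case (3 H rep)
    then have "p_subgroup p G H" by (simp add: p_radical_subgroups_def)
    moreover have "rep C \<in> C" if "C \<in> subset_conj_class G ` p_radical_subgroups p G" for C
      using 3(2) that by (rule bspec)
    ultimately show ?case by (rule sum_orbit_weight_conj_classes[unfolded orbit_weight_def])
  qed
qed

end
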